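(* Let $(\mathcal G, B)$ be a metric $n$-Lie algebra. Let $B(\mathcal G)$ be the vector space spanned by all nondegenerate invariant symmetric bilinear forms on $\mathcal G$, and let $\Gamma_B(\mathcal G)$ be the space of all linear maps $\phi:\mathcal G\to\mathcal G$ such that $\phi([x_1,\dots,x_n])=[\phi(x_1),x_2,\dots,x_n]$ for all $x_1,\dots,x_n\in\mathcal G$ and $B(\phi(x),y)=B(x,\phi(y))$ for all $x,y\in\mathcal G$. Then $$\dim B(\mathcal G)=\dim \Gamma_B(\mathcal G).$$
   Context: Fix an integer $n\ge 2$. All $n$-Lie algebras are finite-dimensional over $\mathbb C$. An $n$-Lie algebra is a vector space $\mathcal G$ with an $n$-multilinear bracket satisfying $[x_1,\dots,x_n]=\mathrm{sign}(\sigma)[x_{\sigma(1)},\dots,x_{\sigma(n)}]$ for all permutations $\sigma\in S_n$ and $[[x_1,\dots,x_n],y_2,\dots,y_n]=\sum_{i=1}^n[x_1,\dots,[x_i,y_2,\dots,y_n],\dots,x_n]$. A bilinear form $K$ on $\mathcal G$ is invariant if $K([x_1,\dots,x_{n-1},y_1],y_2)=-K([x_1,\dots,x_{n-1},y_2],y_1)$ for all $x_i,y_j\in\mathcal G$. A metric $n$-Lie algebra $(\mathcal G,B)$ is an $n$-Lie algebra $\mathcal G$ with a nondegenerate invariant symmetric bilinear form $B$ (not required to be definite). *)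

theory Defs
  imports
    Complex_Main
    "HOL-Library.Function_Algebras"
    "HOL-Combinatorics.Permutations"
begin

text \<open>Pointwise scaling of functions; addition of functions is that of \<^theory>\<open>HOL-Library.Function_Algebras\<close>.\<close>

definition fun_scale :: "('k \<Rightarrow> 'b \<Rightarrow> 'b) \<Rightarrow> 'k \<Rightarrow> ('a \<Rightarrow> 'b) \<Rightarrow> ('a \<Rightarrow> 'b)" where
  "fun_scale s c f = (\<lambda>x. s c (f x))"

lemma vector_space_fun_scale:
  assumes "vector_space s"
  shows "vector_space (fun_scale s)"
proof -
  interpret vector_space s by fact
  show ?thesis
    by unfold_locales (auto simp: fun_scale_def fun_eq_iff scale_right_distrib scale_left_distrib)
qed

abbreviation form_scale :: "complex \<Rightarrow> ('a \<Rightarrow> 'a \<Rightarrow> complex) \<Rightarrow> ('a \<Rightarrow> 'a \<Rightarrow> complex)" where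
  "form_scale \<equiv> fun_scale (fun_scale (*))"

lemma vector_space_form_scale:
  "vector_space (form_scale :: complex \<Rightarrow> ('a \<Rightarrow> 'a \<Rightarrow> complex) \<Rightarrow> _)"
  by (intro vector_space_fun_scale, unfold_locales) (auto simp: algebra_simps)

text \<open>The \<open>n\<close>-ary bracket takes its arguments as a list; its values on lists of length
  other than \<open>n\<close> are irrelevant. Entry \<open>i\<close> of \<open>permute_list p xs\<close> is \<open>xs ! p i\<close>.\<close>

locale n_lie_algebra = vector_space scale
  for scale :: "complex \<Rightarrow> 'a::ab_group_add \<Rightarrow> 'a" +
  fixes n :: nat and br :: "'a list \<Rightarrow> 'a"
  assumes n_ge_2: "n \<ge> 2"
    and finite_dimensional: "\<exists>S. finite S \<and> span S = UNIV"
    and multilinear: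
      "\<And>xs i. length xs = n \<Longrightarrow> i < n \<Longrightarrow> Vector_Spaces.linear scale scale (\<lambda>v. br (xs[i := v]))"
    and skew_symmetric:
      "\<And>xs p. length xs = n \<Longrightarrow> p permutes {..<n} \<Longrightarrow>
         br xs = scale (of_int (sign p)) (br (permute_list p xs))"
    and fundamental_identity:
      "\<And>xs ys. length xs = n \<Longrightarrow> length ys = n - 1 \<Longrightarrow>
         br (br xs # ys) = (\<Sum>i<n. br (xs[i := br (xs ! i # ys)]))"
begin

definition bilinear_form :: "('a \<Rightarrow> 'a \<Rightarrow> complex) \<Rightarrow> bool" where
  "bilinear_form K \<longleftrightarrow>
     (\<forall>x. Vector_Spaces.linear scale (*) (\<lambda>y. K x y)) \<and>
     (\<forall>y. Vector_Spaces.linear scale (*) (\<lambda>x. K x y))"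

definition symmetric_form :: "('a \<Rightarrow> 'a \<Rightarrow> complex) \<Rightarrow> bool" where
  "symmetric_form K \<longleftrightarrow> (\<forall>x y. K x y = K y x)"

definition nondegenerate_form :: "('a \<Rightarrow> 'a \<Rightarrow> complex) \<Rightarrow> bool" where
  "nondegenerate_form K \<longleftrightarrow> (\<forall>x. (\<forall>y. K x y = 0) \<longrightarrow> x = 0)"

definition invariant_form :: "('a \<Rightarrow> 'a \<Rightarrow> complex) \<Rightarrow> bool" where
  "invariant_form K \<longleftrightarrow>
     (\<forall>xs y z. length xs = n - 1 \<longrightarrow> K (br (xs @ [y])) z = - K (br (xs @ [z])) y)"

definition metric_form :: "('a \<Rightarrow> 'a \<Rightarrow> complex) \<Rightarrow> bool" where
  "metric_form K \<longleftrightarrow>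
     bilinear_form K \<and> nondegenerate_form K \<and> invariant_form K \<and> symmetric_form K"

definition metric_form_span :: "('a \<Rightarrow> 'a \<Rightarrow> complex) set" where
  "metric_form_span = module.span form_scale {K. metric_form K}"

definition Gamma :: "('a \<Rightarrow> 'a \<Rightarrow> complex) \<Rightarrow> ('a \<Rightarrow> 'a) set" where
  "Gamma B = {\<phi>. Vector_Spaces.linear scale scale \<phi> \<and>
     (\<forall>x xs. length xs = n - 1 \<longrightarrow> \<phi> (br (x # xs)) = br (\<phi> x # xs)) \<and>
     (\<forall>x y. B (\<phi> x) y = B x (\<phi> y))}"

end

locale metric_n_lie_algebra = n_lie_algebra scale n br
  for scale :: "complex \<Rightarrow> 'a::ab_group_add \<Rightarrow> 'a" and n :: nat and br :: "'a list \<Rightarrow> 'a" +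
  fixes B :: "'a \<Rightarrow> 'a \<Rightarrow> complex"
  assumes metric: "metric_form B"
begin

lemma subspace_Gamma: "module.subspace (fun_scale scale) (Gamma B)"
proof -
  interpret F: vector_space "fun_scale scale :: complex \<Rightarrow> ('a \<Rightarrow> 'a) \<Rightarrow> _"
    by (rule vector_space_fun_scale) unfold_locales
  interpret P: vector_space_pair scale scale by unfold_locales
  interpret vector_space_pair scale "(*) :: complex \<Rightarrow> complex \<Rightarrow> complex"
    by unfold_locales (auto simp: algebra_simps)
  have br: "br ((x + y) # xs) = br (x # xs) + br (y # xs)"
      "br (scale c x # xs) = scale c (br (x # xs))"
      "br (0 # xs) = 0"
    if "length xs = n - 1" for x y c xs
  proof -
    have "module_hom scale scale (\<lambda>v. br (v # xs))"
      using multilinear[of "0 # xs" 0] that n_ge_2 by (simp add: linear_iff_module_hom)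
    from module_hom.add[OF this] module_hom.scale[OF this] module_hom.zero[OF this]
    show "br ((x + y) # xs) = br (x # xs) + br (y # xs)"
      "br (scale c x # xs) = scale c (br (x # xs))" "br (0 # xs) = 0" by auto
  qed
  have B1: "module_hom scale (*) (\<lambda>x. B x y)" and B2: "module_hom scale (*) (B y)" for y
    using metric by (auto simp: metric_form_def bilinear_form_def linear_iff_module_hom)
  note B = module_hom.add[OF B1] module_hom.add[OF B2] module_hom.scale[OF B1]
    module_hom.scale[OF B2] module_hom.zero[OF B1] module_hom.zero[OF B2]
  show ?thesis
    unfolding F.subspace_def Gamma_def mem_Collect_eq fun_scale_def zero_fun_def plus_fun_def
    by (intro conjI allI ballI impI)
      (auto simp: B br P.linear_zero P.linear_compose_add P.linear_compose_scale_right)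
qed

end

end

theory Submission
  imports Defs
begin

text \<open>Sending \<open>\<phi>\<close> to the form \<open>B(\<phi> x, y)\<close> identifies \<open>\<Gamma>\<^sub>B\<close> with the space of all invariant
  symmetric forms: injectivity is nondegeneracy of \<open>B\<close>, and surjectivity is Riesz representation
  with respect to \<open>B\<close>, where invariance of the form translates into the centroid identity for \<open>\<phi>\<close>.
  The nondegenerate invariant forms already span this space, since \<open>\<phi> = (\<phi> - c) + c\<close> and
  \<open>\<phi> - c\<close> is invertible as soon as \<open>c\<close> is not one of the finitely many eigenvalues of \<open>\<phi>\<close>.\<close>

section \<open>Linear algebra: eigenvectors, Riesz representation, dimension of an image\<close>

context vector_space
begin

text \<open>Independence of eigenvectors, indexed by their eigenvalues. Applying \<open>f\<close> to
  a relation and subtracting \<open>a\<close> times the relation removes the term of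
  \<open>a\<close> and multiplies every other coefficient by the nonzero
  \<open>c - a\<close>.\<close>

lemma eigenvectors_sum_eq_0:
  assumes f: "Vector_Spaces.linear scale scale f"
    and v: "\<And>c. c \<in> C \<Longrightarrow> f (v c) = c *s v c" "\<And>c. c \<in> C \<Longrightarrow> v c \<noteq> 0"
    and "finite C" "(\<Sum>c\<in>C. u c *s v c) = 0" "d \<in> C"
  shows "u d = 0"
  using \<open>finite C\<close> v assms(5,6)
proof (induction C arbitrary: u d rule: finite_induct)
  case (insert a C)
  interpret f: Vector_Spaces.linear scale scale f by fact
  have "f (\<Sum>c\<in>insert a C. u c *s v c) = (\<Sum>c\<in>insert a C. (u c * c) *s v c)"
    unfolding f.sum f.scale using insert.prems(1) by (intro sum.cong) auto
  then have "0 = (\<Sum>c\<in>insert a C. (u c * c) *s v c) - a *s (\<Sum>c\<in>insert a C. u c *s v c)"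
    by (simp only: insert.prems(3) f.zero scale_zero_right diff_self)
  also have "\<dots> = (\<Sum>c\<in>insert a C. (u c * (c - a)) *s v c)"
    unfolding scale_sum_right sum_subtractf [symmetric]
    by (intro sum.cong refl) (simp add: right_diff_distrib scale_left_diff_distrib mult.commute)
  also have "\<dots> = (\<Sum>c\<in>C. (u c * (c - a)) *s v c)"
    using insert.hyps by simp
  finally have "(\<Sum>c\<in>C. (u c * (c - a)) *s v c) = 0"
    by (rule sym)
  then have "u c * (c - a) = 0" if "c \<in> C" for c
    using insert.IH[of "\<lambda>c. u c * (c - a)"] insert.prems that by simp
  then have C: "u c = 0" if "c \<in> C" for c
    using that insert.hyps by auto
  then have "u a *s v a = 0"
    using insert.prems(3) insert.hyps by simp
  then have "u a = 0"
    using insert.prems(2)[of a] by simp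
  with C insert.prems(4) show ?case by auto
qed simp

end

context finite_dimensional_vector_space
begin

text \<open>If every scalar were an eigenvalue, one eigenvector for each would form an infinite
  independent set, which finite dimension excludes.\<close>

lemma ex_not_eigenvalue:
  assumes f: "Vector_Spaces.linear scale scale f" and inf: "infinite (UNIV :: 'a set)"
  shows "\<exists>c. \<forall>x. f x = c *s x \<longrightarrow> x = 0"
proof (rule ccontr)
  assume "\<nexists>c. \<forall>x. f x = c *s x \<longrightarrow> x = 0"
  then obtain v where v: "\<And>c. f (v c) = c *s v c" "\<And>c. v c \<noteq> 0"
    by metis
  \<comment> \<open>A nonzero vector has at most one eigenvalue. Injectivity makes
    \<open>range v\<close> infinite and lets sums over it be reindexed by scalars.\<close>
  have inj: "inj v"
  proof (rule injI)
    fix c d assume eq: "v c = v d"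
    have "c *s v c = d *s v c"
      using v(1) eq by metis
    with v(2)[of c] show "c = d"
      unfolding scale_cancel_right by blast
  qed
  have "independent (range v)"
    unfolding independent_explicit_module
  proof (intro allI impI)
    fix t u x
    assume t: "finite t" "t \<subseteq> range v" "(\<Sum>w\<in>t. u w *s w) = 0" "x \<in> t"
    obtain C where C: "t = v ` C"
      using t(2) by (auto simp: subset_image_iff)
    have inj_C: "inj_on v C"
      using inj by (rule inj_on_subset) simp
    have "finite C"
      using t(1) inj_C C by (simp add: finite_image_iff)
    moreover have "(\<Sum>c\<in>C. u (v c) *s v c) = 0"
      using t(3) by (simp add: C sum.reindex[OF inj_C])
    ultimately show "u x = 0"
      using eigenvectors_sum_eq_0[OF f v, of C "\<lambda>c. u (v c)"] t(4) C by auto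
  qed
  then have "finite (range v)"
    by (rule finiteI_independent)
  with inj inf show False
    by (simp add: finite_image_iff)
qed

text \<open>Riesz representation. Recording a functional as the vector whose coordinates are its
  values on \<open>Basis\<close> turns the assignment of \<open>b x\<close> to \<open>x\<close> into
  an injective endomorphism, which finite dimension makes surjective.\<close>

lemma nondegenerate_represents:
  assumes lin: "\<And>x. Vector_Spaces.linear scale (*) (b x)"
      "\<And>y. Vector_Spaces.linear scale (*) (\<lambda>x. b x y)"
    and nondeg: "\<And>x. (\<And>y. b x y = 0) \<Longrightarrow> x = 0"
    and g: "Vector_Spaces.linear scale (*) g"
  shows "\<exists>x. b x = g"
proof -
  interpret P: vector_space_pair scale "(*) :: 'a \<Rightarrow> 'a \<Rightarrow> 'a"
    by unfold_locales (auto simp: algebra_simps)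
  interpret S: vector_space_pair scale scale by unfold_locales
  define R where "R h = (\<Sum>e\<in>Basis. h e *s e)" for h :: "'b \<Rightarrow> 'a"
  have R: "h = h'" if "R h = R h'" and h: "Vector_Spaces.linear scale (*) h"
    "Vector_Spaces.linear scale (*) h'" for h h'
  proof (rule ext)
    fix y
    \<comment> \<open>Independence of \<open>Basis\<close> recovers the coordinates, and a linear
      functional is determined by its values on \<open>Basis\<close>.\<close>
    have "(\<Sum>e\<in>Basis. (h e - h' e) *s e) = 0"
      using that(1) by (simp add: R_def scale_left_diff_distrib sum_subtractf)
    then have "h e = h' e" if "e \<in> Basis" for e
      using independentD[OF independent_Basis finite_Basis order_refl] that by fastforce
    then show "h y = h' y"
      using P.linear_eq_on[OF h, of y Basis] by (simp add: span_Basis)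
  qed
  have linR: "Vector_Spaces.linear scale scale (\<lambda>x. R (b x))"
    unfolding R_def
    by (intro S.linear_compose_sum ballI)
      (use lin(2) in \<open>auto simp: Vector_Spaces.linear_iff scale_left_distrib vector_space_axioms\<close>)
  have "inj (\<lambda>x. R (b x))"
    unfolding S.linear_inj_iff_eq_0[OF linR]
  proof (intro allI impI)
    fix x assume "R (b x) = 0"
    then have "R (b x) = R (\<lambda>_. 0)" by (simp add: R_def)
    then have "b x = (\<lambda>_. 0)"
      using lin(1) P.linear_0 by (intro R) (auto intro: P.linear_zero)
    then show "x = 0" by (intro nondeg) simp
  qed
  then have "surj (\<lambda>x. R (b x))"
    by (rule linear_inj_imp_surj[OF linR])
  then obtain x where "R (b x) = R g"
    by (metis surjD)
  then show ?thesis
    using R lin(1) g by blast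
qed

end

text \<open>An injective linear map carries a basis of the span of \<open>S\<close> to a basis of
  the span of the image. Neither ambient space is assumed finite-dimensional, since spaces of
  arbitrary maps need not be.\<close>

lemma dim_image_eq_of_inj:
  assumes "Vector_Spaces.linear s1 s2 f" "inj f"
  shows "vector_space.dim s2 (f ` S) = vector_space.dim s1 S"
proof -
  interpret f: Vector_Spaces.linear s1 s2 f by fact
  obtain b where b: "b \<subseteq> S" "f.vs1.independent b" "S \<subseteq> f.vs1.span b" "card b = f.vs1.dim S"
    by (rule f.vs1.basis_exists)
  have "f.vs1.span b = f.vs1.span S"
    using b by (simp add: f.vs1.span_eq f.vs1.span_superset[THEN subset_trans[OF b(1)]])
  then have "f.vs2.span (f ` b) = f.vs2.span (f ` S)"
    by (simp add: f.span_image)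
  moreover have "f.vs2.independent (f ` b)"
    using f.independent_injective_image[OF b(2)] assms(2) by (auto intro: inj_on_subset)
  ultimately have "f.vs2.dim (f ` S) = card (f ` b)"
    by (rule f.vs2.dim_eq_card)
  also have "\<dots> = card b"
    using assms(2) by (intro card_image) (auto intro: inj_on_subset)
  finally show ?thesis using b(4) by simp
qed

section \<open>Passing between the first and the last slot of the bracket\<close>

context n_lie_algebra
begin

text \<open>\<open>Gamma\<close> acts on the first argument of the bracket, whereas
  \<open>invariant_form\<close> moves the last one; this exchange links the two conventions.\<close>

lemma br_swap_ends:
  assumes "length ws = n - 2"
  shows "br (y # ws @ [z]) = - br (z # ws @ [y])"
proof -
  \<comment> \<open>As n \<ge> 2, the positions \<open>0\<close> and \<open>n - 1\<close> differ, so
    this transposition is odd.\<close>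
  let ?p = "Transposition.transpose 0 (n - 1)" and ?xs = "y # ws @ [z]"
  have p: "?p permutes {..<n}"
    using n_ge_2 by (intro permutes_swap_id) auto
  have len: "length ?xs = n"
    using assms n_ge_2 by simp
  have "permute_list ?p ?xs = z # ws @ [y]"
  proof (rule nth_equalityI)
    fix i assume "i < length (permute_list ?p ?xs)"
    then have i: "i < n" using len by simp
    then have "permute_list ?p ?xs ! i = ?xs ! ?p i"
      using p len by (intro permute_list_nth) simp_all
    also have "\<dots> = (z # ws @ [y]) ! i"
      using i assms n_ge_2
      by (auto simp: Transposition.transpose_def nth_append nth_Cons split: nat.split)
    finally show "permute_list ?p ?xs ! i = (z # ws @ [y]) ! i" .
  qed (use len in simp)
  then show ?thesis
    using skew_symmetric[OF len p] n_ge_2 by (simp add: sign_swap_id)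
qed

lemma length_eq_pred_snocE:
  assumes "length xs = n - 1"
  obtains ws a where "xs = ws @ [a]" "length ws = n - 2"
  using assms n_ge_2 by (cases xs rule: rev_cases) auto

lemma length_eq_pred_ConsE:
  assumes "length xs = n - 1"
  obtains ws a where "xs = a # ws" "length ws = n - 2"
  using assms n_ge_2 by (cases xs) auto

text \<open>Exchanging the ends of the bracket on both sides costs two signs, which cancel.\<close>

lemma invariant_form_head:
  assumes K: "bilinear_form K" "invariant_form K" and xs: "length xs = n - 1"
  shows "K (br (y # xs)) z = - K (br (z # xs)) y"
proof -
  obtain ws a where ws: "xs = ws @ [a]" "length ws = n - 2"
    using xs by (rule length_eq_pred_snocE)
  have neg: "K (- u) v = - K u v" for u v
    using K(1) module_hom.neg[of scale "(*)" "\<lambda>x. K x v"]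
    by (auto simp: bilinear_form_def linear_iff_module_hom)
  \<comment> \<open>Putting the last entry \<open>a\<close> of \<open>xs\<close> in front frees the
    last slot, where invariance applies.\<close>
  have "K (br ((a # ws) @ [y])) z = - K (br ((a # ws) @ [z])) y"
    using K(2) ws xs unfolding invariant_form_def by (metis length_Cons length_append_singleton)
  then have "- K (br (y # xs)) z = K (br (z # xs)) y"
    using br_swap_ends[OF ws(2), of a] neg by (simp add: ws(1))
  then show ?thesis by (metis minus_minus)
qed

end

section \<open>The correspondence between \<open>Gamma B\<close> and invariant symmetric
  forms\<close>

context metric_n_lie_algebra
begin

lemma bilinear_B: "bilinear_form B" and nondegenerate_B: "nondegenerate_form B"
  and invariant_B: "invariant_form B" and symmetric_B: "B x y = B y x"
  using metric by (auto simp: metric_form_def symmetric_form_def)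

lemma linear_B:
  "Vector_Spaces.linear scale (*) (B x)" "Vector_Spaces.linear scale (*) (\<lambda>x. B x y)"
  using bilinear_B by (auto simp: bilinear_form_def)

lemma B_add: "B (x + x') y = B x y + B x' y"
  and B_scale: "B (scale c x) y = c * B x y"
  and B_minus: "B (- x) y = - B x y"
proof -
  interpret Vector_Spaces.linear scale "(*)" "\<lambda>x. B x y" by (rule linear_B)
  show "B (x + x') y = B x y + B x' y" "B (scale c x) y = c * B x y" "B (- x) y = - B x y"
    by (rule add scale neg)+
qed

lemma B_eqI:
  assumes "\<And>y. B x y = B x' y"
  shows "x = x'"
proof -
  have "B (x - x') y = 0" for y
    using assms B_add[of x "- x'" y] by (simp add: B_minus)
  then have "x - x' = 0"
    using nondegenerate_B unfolding nondegenerate_form_def by blast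
  then show ?thesis by simp
qed

lemma finite_basis: "\<exists>Basis. finite_dimensional_vector_space scale Basis"
proof -
  obtain S where S: "finite S" "span S = UNIV"
    using finite_dimensional by blast
  obtain b where b: "b \<subseteq> S" "independent b" "S \<subseteq> span b"
    using basis_exists[of S] by metis
  have "span b = UNIV"
    using S(2) b(3) span_minimal[OF b(3) subspace_span] by auto
  then show ?thesis
    using b S(1) by (intro exI[of _ b], unfold_locales) (auto intro: finite_subset)
qed

definition form_of :: "('a \<Rightarrow> 'a) \<Rightarrow> 'a \<Rightarrow> 'a \<Rightarrow> complex" where
  "form_of \<phi> = (\<lambda>x. B (\<phi> x))"

lemma linear_form_of: "Vector_Spaces.linear (fun_scale scale) form_scale form_of"
  unfolding Vector_Spaces.linear_iff
  using vector_space_fun_scale[OF vector_space_axioms] vector_space_form_scale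
  by (simp add: form_of_def fun_eq_iff fun_scale_def B_add B_scale)

lemma inj_form_of: "inj form_of"
  by (rule injI) (auto simp: form_of_def fun_eq_iff intro: B_eqI)

text \<open>Swap the ends, pull \<phi> through the first slot, and swap back; the two signs cancel
  by linearity of \<phi>.\<close>

lemma Gamma_br_last:
  assumes \<phi>: "\<phi> \<in> Gamma B" and xs: "length xs = n - 1"
  shows "\<phi> (br (xs @ [y])) = br (xs @ [\<phi> y])"
proof -
  obtain ws a where ws: "xs = a # ws" "length ws = n - 2"
    using xs by (rule length_eq_pred_ConsE)
  interpret \<phi>: Vector_Spaces.linear scale scale \<phi>
    using \<phi> by (simp add: Gamma_def)
  have "\<phi> (br (y # ws @ [a])) = br (\<phi> y # ws @ [a])"
    using \<phi> ws xs by (simp add: Gamma_def)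
  then show ?thesis
    using br_swap_ends[OF ws(2), of a] by (simp add: ws(1) \<phi>.neg)
qed

lemma form_of_Gamma:
  assumes \<phi>: "\<phi> \<in> Gamma B"
  shows "bilinear_form (form_of \<phi>)" "invariant_form (form_of \<phi>)" "symmetric_form (form_of \<phi>)"
proof -
  have \<phi>_lin: "Vector_Spaces.linear scale scale \<phi>" and \<phi>_adj: "B (\<phi> x) y = B x (\<phi> y)" for x y
    using \<phi> by (auto simp: Gamma_def)
  show "bilinear_form (form_of \<phi>)"
    unfolding bilinear_form_def form_of_def
    using linear_B Vector_Spaces.linear_compose[OF \<phi>_lin linear_B(2)] by (auto simp: o_def)
  show "symmetric_form (form_of \<phi>)"
    unfolding symmetric_form_def form_of_def using \<phi>_adj symmetric_B by metis
  \<comment> \<open>Writing [..] for \<open>br\<close>: B (\<phi> [xs, y]) z = B [xs, \<phi> y] z =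
    - B [xs, z] (\<phi> y) = - B (\<phi> [xs, z]) y.\<close>
  show "invariant_form (form_of \<phi>)"
    unfolding invariant_form_def form_of_def
    using Gamma_br_last[OF \<phi>] invariant_B \<phi>_adj by (metis invariant_form_def)
qed

lemma invariant_form_in_form_of_Gamma:
  assumes K: "bilinear_form K" "invariant_form K" "symmetric_form K"
  shows "K \<in> form_of ` Gamma B"
proof -
  obtain Basis where "finite_dimensional_vector_space scale Basis"
    using finite_basis by blast
  then interpret F: finite_dimensional_vector_space scale Basis .
  have K_lin: "Vector_Spaces.linear scale (*) (K x)"
    "Vector_Spaces.linear scale (*) (\<lambda>x. K x y)" for x y
    using K(1) by (auto simp: bilinear_form_def)
  \<comment> \<open>The vector representing the functional \<open>K x\<close> through
    \<open>B\<close> serves as \<phi> x. It is unique by nondegeneracy, which makes \<phi>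
    linear.\<close>
  have "\<exists>x'. B x' = K x" for x
    using linear_B nondegenerate_B K_lin(1)
    by (intro F.nondegenerate_represents) (auto simp: nondegenerate_form_def)
  then obtain \<phi> where \<phi>: "\<And>x. B (\<phi> x) = K x"
    by metis
  have "Vector_Spaces.linear scale scale \<phi>"
    unfolding Vector_Spaces.linear_iff
    using K_lin(2) by (auto intro!: B_eqI vector_space_axioms simp: B_add B_scale \<phi> Vector_Spaces.linear_iff)
  \<comment> \<open>Tested against \<open>z\<close>: invariance of \<open>K\<close> exchanges
    \<open>x\<close> and \<open>z\<close>, symmetry rewrites \<open>K\<close> as \<open>B\<close>
    with \<phi> x outside the bracket, and invariance of \<open>B\<close> moves \<phi> x into
    it.\<close>
  moreover have "\<phi> (br (x # xs)) = br (\<phi> x # xs)" if xs: "length xs = n - 1" for x xs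
  proof (rule B_eqI)
    fix z
    have "B (\<phi> (br (x # xs))) z = - K (br (z # xs)) x"
      unfolding \<phi> by (rule invariant_form_head[OF K(1,2) xs])
    also have "\<dots> = - B (br (z # xs)) (\<phi> x)"
      using K(3) by (metis \<phi> symmetric_B symmetric_form_def)
    also have "\<dots> = B (br (\<phi> x # xs)) z"
      by (rule invariant_form_head[OF bilinear_B invariant_B xs, symmetric])
    finally show "B (\<phi> (br (x # xs))) z = B (br (\<phi> x # xs)) z" .
  qed
  moreover have "B (\<phi> x) y = B x (\<phi> y)" for x y
    using K(3) by (metis \<phi> symmetric_B symmetric_form_def)
  ultimately have "\<phi> \<in> Gamma B"
    by (simp add: Gamma_def)
  moreover have "K = form_of \<phi>"
    by (simp add: form_of_def \<phi>)
  ultimately show ?thesis by blast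
qed

lemma metric_form_span_eq: "metric_form_span = form_of ` Gamma B"
proof -
  interpret f: Vector_Spaces.linear "fun_scale scale" form_scale form_of
    by (rule linear_form_of)
  obtain Basis where "finite_dimensional_vector_space scale Basis"
    using finite_basis by blast
  then interpret F: finite_dimensional_vector_space scale Basis .
  have id: "id \<in> Gamma B"
    by (simp add: Gamma_def linear_id)
  have "form_of \<phi> \<in> metric_form_span" if \<phi>: "\<phi> \<in> Gamma B" for \<phi>
  proof -
    \<comment> \<open>Such a \<open>c\<close> exists because the complex field is infinite; it makes
      \<phi> - c injective, so the associated form is nondegenerate.\<close>
    obtain c where c: "\<And>x. \<phi> x = scale c x \<Longrightarrow> x = 0"
      using F.ex_not_eigenvalue[of \<phi>] \<phi> by (auto simp: Gamma_def infinite_UNIV_char_0)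
    define \<psi> where "\<psi> = \<phi> - fun_scale scale c id"
    have \<psi>: "\<psi> \<in> Gamma B"
      unfolding \<psi>_def
      using \<phi> id subspace_Gamma by (intro f.vs1.subspace_diff f.vs1.subspace_scale)
    have "nondegenerate_form (form_of \<psi>)"
      unfolding nondegenerate_form_def
    proof (intro allI impI)
      fix x assume "\<forall>y. form_of \<psi> x y = 0"
      then have "\<psi> x = 0"
        using nondegenerate_B by (simp add: form_of_def nondegenerate_form_def)
      then show "x = 0"
        by (intro c) (simp add: \<psi>_def fun_scale_def)
    qed
    then have "metric_form (form_of \<psi>)"
      using form_of_Gamma[OF \<psi>] by (simp add: metric_form_def)
    \<comment> \<open>The scalar part contributes a multiple of \<open>B\<close>, itself a metric
      form, so \<open>form_of \<phi>\<close> is a combination of two metric forms.\<close>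
    moreover have "form_of id = B"
      by (simp add: form_of_def)
    ultimately have "form_of \<psi> + form_scale c (form_of id) \<in> metric_form_span"
      unfolding metric_form_span_def using metric
      by (intro f.vs2.span_add f.vs2.span_scale f.vs2.span_base) simp_all
    also have "form_of \<psi> + form_scale c (form_of id) = form_of \<phi>"
      by (simp add: \<psi>_def flip: f.scale f.add)
    finally show ?thesis .
  qed
  \<comment> \<open>Every metric form lies in the image, and the linear image of the subspace
    \<open>Gamma B\<close> is a subspace, so it contains their span.\<close>
  moreover have "metric_form_span \<subseteq> form_of ` Gamma B"
    unfolding metric_form_span_def
    using subspace_Gamma invariant_form_in_form_of_Gamma
    by (intro f.vs2.span_minimal f.subspace_image) (auto simp: metric_form_def)
  ultimately show ?thesis by auto
qed

end

theorem theorem3p3: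
  fixes scale :: "complex \<Rightarrow> 'a::ab_group_add \<Rightarrow> 'a"
    and n :: nat
    and br :: "'a list \<Rightarrow> 'a"
    and B :: "'a \<Rightarrow> 'a \<Rightarrow> complex"
  assumes "metric_n_lie_algebra scale n br B"
  shows "vector_space.dim form_scale (n_lie_algebra.metric_form_span scale n br) =
         vector_space.dim (fun_scale scale) (n_lie_algebra.Gamma scale n br B)"
proof -
  interpret metric_n_lie_algebra scale n br B by fact
  show ?thesis
    unfolding metric_form_span_eq using linear_form_of inj_form_of by (rule dim_image_eq_of_inj)
qed

end
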